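(* Let $G=(V,E)$ be a graph on $n$ vertices. Then $$\xi(\overline{G})=\min\{k\in\mathbb{Z} : 0\le k\le n,\ \varphi_k(G)=n\}.$$
   Context: Graphs are finite and simple with nonempty vertex set $V$; $\overline{G}$ is the complement of $G$ and $A_G$ is the adjacency matrix of $G$. $\mathbb{S}^V_+$ is the set of positive semidefinite real symmetric $V\times V$ matrices; $A\preceq B$ means $B-A$ is positive semidefinite. $I$ is the identity, $\mathbf{1}$ the all-ones vector, $\circ$ the entrywise product, $\langle A,B\rangle=\operatorname{trace}(AB)$, and $\operatorname{diag}(Y)$ is the vector of diagonal entries of $Y$. An orthonormal representation of a graph $H$ is a map $u\colon V(H)\to\mathbb{R}^m$ (for some $m$) such that $\|u_i\|=1$ for all $i\in V(H)$ and $\langle u_i,u_j\rangle=0$ whenever $ij\in E(\overline{H})$. $\xi(H)$ denotes the minimum dimension $m$ for which $H$ has an orthonormal representation in $\mathbb{R}^m$. (So in an orthonormal representation of $\overline{G}$, the vectors of vertices adjacent in $G$ are orthogonal.) For real $k\in[0,n]$, $$\varphi_k(G)=\max\{\langle M,Y\rangle : M,Y\in\mathbb{S}^V_+,\ \operatorname{diag}(Y)=\mathbf{1},\ A_G\circ Y=0,\ \langle I,M\rangle=k,\ M\preceq I\};$$ for integer $k$ this equals the maximum of the sum of the $k$ largest eigenvalues of $Y$ over $Y\in\mathbb{S}^V_+$ with $\operatorname{diag}(Y)=\mathbf{1}$ and $A_G\circ Y=0$. *)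

theory Defs
  imports "HOL-Analysis.Analysis"
begin

text \<open>
  A graph is a symmetric irreflexive adjacency relation on a finite type, whose elements are
  the vertices: the number of vertices is the cardinality of the type, and the vertex set is
  nonempty because types are.
\<close>

definition simple_graph :: "('v::finite \<Rightarrow> 'v \<Rightarrow> bool) \<Rightarrow> bool" where
  "simple_graph G \<longleftrightarrow> symp G \<and> irreflp G"

definition complement :: "('v::finite \<Rightarrow> 'v \<Rightarrow> bool) \<Rightarrow> 'v \<Rightarrow> 'v \<Rightarrow> bool" where
  "complement G i j \<longleftrightarrow> i \<noteq> j \<and> \<not> G i j"

definition adjacency_matrix :: "('v::finite \<Rightarrow> 'v \<Rightarrow> bool) \<Rightarrow> real^'v^'v" where
  "adjacency_matrix G = (\<chi> i j. if G i j then 1 else 0)"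

text \<open>
  Since the dimension has to vary, a vector of dimension \<open>m\<close> is given by the values of a
  function on \<open>{..<m}\<close>; \<open>L2_set\<close> is then the Euclidean norm. Values outside \<open>{..<m}\<close> are
  irrelevant.
\<close>

definition orthonormal_representation ::
    "nat \<Rightarrow> ('v::finite \<Rightarrow> 'v \<Rightarrow> bool) \<Rightarrow> ('v \<Rightarrow> nat \<Rightarrow> real) \<Rightarrow> bool" where
  "orthonormal_representation m H u \<longleftrightarrow>
     (\<forall>i. L2_set (u i) {..<m} = 1) \<and>
     (\<forall>i j. complement H i j \<longrightarrow> (\<Sum>l<m. u i l * u j l) = 0)"

definition xi :: "('v::finite \<Rightarrow> 'v \<Rightarrow> bool) \<Rightarrow> nat" where
  "xi H = (LEAST m. \<exists>u. orthonormal_representation m H u)"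

definition psd :: "real^'v^'v \<Rightarrow> bool" where
  "psd A \<longleftrightarrow> transpose A = A \<and> (\<forall>x. 0 \<le> x \<bullet> (A *v x))"

definition loewner_le :: "real^'v^'v \<Rightarrow> real^'v^'v \<Rightarrow> bool"  (infix \<open>\<preceq>\<close> 50) where
  "A \<preceq> B \<longleftrightarrow> psd (B - A)"

definition diag :: "real^'v^'v \<Rightarrow> real^'v" where
  "diag A = (\<chi> i. A $ i $ i)"

definition trace_inner :: "real^'v^'v \<Rightarrow> real^'v^'v \<Rightarrow> real" where
  "trace_inner A B = trace (A ** B)"

text \<open>
  Below, \<open>*\<close> between matrices is the entrywise product (matrix multiplication is \<open>**\<close>), the
  vector \<open>1\<close> is the all-ones vector, and the identity matrix is \<open>mat 1\<close>.
\<close>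

definition phi_feasible ::
    "('v::finite \<Rightarrow> 'v \<Rightarrow> bool) \<Rightarrow> real \<Rightarrow> real^'v^'v \<Rightarrow> real^'v^'v \<Rightarrow> bool" where
  "phi_feasible G k M Y \<longleftrightarrow>
     psd M \<and> psd Y \<and> diag Y = 1 \<and> adjacency_matrix G * Y = 0 \<and>
     trace_inner (mat 1) M = k \<and> M \<preceq> mat 1"

definition phi :: "('v::finite \<Rightarrow> 'v \<Rightarrow> bool) \<Rightarrow> real \<Rightarrow> real" where
  "phi G k = (GREATEST x. \<exists>M Y. phi_feasible G k M Y \<and> x = trace_inner M Y)"

end

theory Submission
  imports Defs
begin

text \<open>
  A dimension \<open>k \<le> n\<close> admits an orthonormal representation of the complement of \<open>G\<close> exactly when
  \<open>phi G k = n\<close> (lemma \<open>phi_eq_card_iff\<close>); the theorem compares the least elements of the two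
  sets of dimensions, which contain \<open>n\<close> because of the standard basis. The Gram matrices of
  representations of dimension \<open>k\<close> are the feasible matrices \<open>Y\<close> of rank at most \<open>k\<close>, and the
  matrix \<open>M\<close> is there to detect that rank. Since \<open>I - M\<close> and \<open>Y\<close> are positive semidefinite,
  \<open>\<langle>M, Y\<rangle> = n - \<langle>I - M, Y\<rangle> \<le> n\<close>.

  Given a representation, take for \<open>M\<close> the projection onto a \<open>k\<close>-dimensional space that contains
  the range of \<open>Y\<close>. Then \<open>MY = Y\<close>, and \<open>\<langle>M, Y\<rangle> = trace Y = n\<close>
  (\<open>feasible_of_representation\<close>).

  Conversely, if \<open>\<langle>M, Y\<rangle> = n\<close> then \<open>\<langle>I - M, Y\<rangle> = 0\<close>, which forces \<open>(I - M) Y = 0\<close>. The ranges of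
  the symmetric matrices \<open>I - M\<close> and \<open>Y\<close> are therefore orthogonal and their ranks add up to at
  most \<open>n\<close>. A positive semidefinite matrix below \<open>I\<close> has trace at most its rank, so \<open>I - M\<close> has rank
  at least \<open>n - k\<close>, and \<open>Y\<close> has rank at most \<open>k\<close> (\<open>representation_of_feasible\<close>). Compactness of
  the feasible set makes \<open>phi\<close> an attained maximum, so that a value \<open>n\<close> does come from a feasible
  pair.

  All the facts on positive semidefinite matrices come from one decomposition, in place of
  eigenvalues: such a matrix is a sum of at most \<open>rank A\<close> matrices \<open>w w\<^sup>T\<close>
  (\<open>psd_gram_decomposition\<close>).
\<close>

section \<open>Rank-one matrices and the trace inner product\<close>

definition outer_square :: "real^'v::finite \<Rightarrow> real^'v^'v" where
  "outer_square w = (\<chi> i j. w $ i * w $ j)"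

lemma outer_square_mult_vec: "outer_square w *v x = (w \<bullet> x) *\<^sub>R w"
  by (simp add: outer_square_def matrix_vector_mult_def vec_eq_iff inner_vec_def sum_distrib_left
      sum_distrib_right mult_ac)

lemma sum_mult_vec: "(\<Sum>l\<in>S. A l :: real^'n::finite^'m::finite) *v x = (\<Sum>l\<in>S. A l *v x)"
  by (induction S rule: infinite_finite_induct) (simp_all add: matrix_vector_mult_add_rdistrib)

lemma transpose_sum: "transpose (\<Sum>l\<in>S. A l :: real^'n::finite^'m::finite) = (\<Sum>l\<in>S. transpose (A l))"
  by (simp add: transpose_def vec_eq_iff)

lemma transpose_outer_square: "transpose (outer_square w) = outer_square w"
  by (simp add: transpose_def outer_square_def mult.commute)

lemma trace_inner_entries: "trace_inner A B = (\<Sum>i\<in>UNIV. \<Sum>j\<in>UNIV. A $ i $ j * B $ j $ i)"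
  by (simp add: trace_inner_def trace_def matrix_matrix_mult_def)

lemma trace_inner_outer_square: "trace_inner A (outer_square w) = w \<bullet> (A *v w)"
  by (simp add: trace_inner_entries outer_square_def inner_vec_def matrix_vector_mult_def
      sum_distrib_left mult_ac)

lemma trace_inner_sum_right: "trace_inner A (\<Sum>l\<in>S. B l) = (\<Sum>l\<in>S. trace_inner A (B l))"
proof (induction S rule: infinite_finite_induct)
  case (insert x F)
  then show ?case
    by (simp add: trace_inner_entries distrib_left sum.distrib flip: sum_distrib_left)
qed (simp_all add: trace_inner_entries)

lemma trace_inner_mat_1: "trace_inner (mat 1) A = trace A"
  by (simp add: trace_inner_def)

lemma trace_inner_mat_1_diff: "trace_inner (mat 1 - A) B = trace B - trace_inner A B"
  by (simp add: trace_inner_entries left_diff_distrib sum_subtractf flip: trace_inner_mat_1)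

section \<open>Positive semidefinite matrices\<close>

lemma psd_symmetric:
  assumes "psd A"
  shows "x \<bullet> (A *v y) = y \<bullet> (A *v x)"
proof -
  have "x \<bullet> (A *v y) = (transpose A *v x) \<bullet> y"
    by (simp add: dot_lmul_matrix)
  then show ?thesis
    using assms unfolding psd_def by (metis inner_commute)
qed

lemma psd_nonneg: "psd A \<Longrightarrow> 0 \<le> x \<bullet> (A *v x)"
  by (simp add: psd_def)

lemma quadratic_form_add_scaled:
  assumes "psd A"
  shows "(x + t *\<^sub>R y) \<bullet> (A *v (x + t *\<^sub>R y))
    = x \<bullet> (A *v x) + 2 * t * (y \<bullet> (A *v x)) + t\<^sup>2 * (y \<bullet> (A *v y))"
  using psd_symmetric[OF assms, of x y]
  by (simp add: matrix_vector_right_distrib matrix_vector_mult_scaleR inner_simps power2_eq_square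
      algebra_simps)

text \<open>
  Otherwise the form would become negative at \<open>x - s (A x)\<close> for a small \<open>s > 0\<close>: there its
  linear term in \<open>s\<close> is negative and its constant term vanishes.
\<close>

lemma psd_quadratic_form_eq_0:
  assumes "psd A" "x \<bullet> (A *v x) = 0"
  shows "A *v x = 0"
proof (rule ccontr)
  \<comment> \<open>With \<open>q + 1\<close> in the denominator, \<open>t\<close> works also if \<open>q = 0\<close>.\<close>
  define z q t where "z = A *v x" and "q = z \<bullet> (A *v z)" and "t = - (z \<bullet> z) / (q + 1)"
  assume "A *v x \<noteq> 0"
  then have pos: "0 < z \<bullet> z"
    by (simp add: z_def)
  have q: "0 \<le> q"
    using psd_nonneg[OF assms(1)] by (simp add: q_def)
  have "0 \<le> 2 * t * (z \<bullet> z) + t\<^sup>2 * q"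
    using psd_nonneg[OF assms(1), of "x + t *\<^sub>R z"] assms(2)
    by (simp add: quadratic_form_add_scaled[OF assms(1)] q_def flip: z_def)
  also have "\<dots> = (z \<bullet> z)\<^sup>2 * (- q - 2) / (q + 1)\<^sup>2"
    using q unfolding t_def by (simp add: divide_simps) (simp add: algebra_simps power2_eq_square)
  also have "\<dots> < 0"
    using q pos by (intro divide_neg_pos mult_pos_neg) auto
  finally show False
    by simp
qed

lemma psd_scaled_mat_1: "0 \<le> c \<Longrightarrow> psd (c *\<^sub>R mat 1)"
  by (simp add: psd_def transpose_scalar transpose_mat flip: scaleR_matrix_vector_assoc)

lemma psd_sum_outer_squares: "psd (\<Sum>l\<in>S. outer_square (w l))"
  by (auto simp: psd_def transpose_sum transpose_outer_square sum_mult_vec outer_square_mult_vec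
      inner_sum_right inner_commute intro!: sum_nonneg)

text \<open>
  Subtracting \<open>w w\<^sup>T\<close> with \<open>w = A e / \<surd>(e\<^sup>T A e)\<close> is a Gaussian elimination step in the direction
  \<open>e\<close>. The form of the difference at \<open>x\<close> is the minimum of the form of \<open>A\<close> on the line through
  \<open>x\<close> with direction \<open>e\<close>, so it stays nonnegative. The new range lies
  in the old one and is orthogonal to \<open>e\<close>, whereas \<open>A e\<close> is not; hence the rank drops.
\<close>

lemma psd_deflate:
  assumes A: "psd A" and pos: "0 < e \<bullet> (A *v e)"
  defines "w \<equiv> (1 / sqrt (e \<bullet> (A *v e))) *\<^sub>R (A *v e)"
  shows "psd (A - outer_square w)" "rank (A - outer_square w) < rank A"
proof -
  define d where "d = e \<bullet> (A *v e)"
  have d: "0 < d" "sqrt d * sqrt d = d"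
    using pos by (simp_all add: d_def)
  have mult: "(A - outer_square w) *v x = A *v x - ((A *v e) \<bullet> x / d) *\<^sub>R (A *v e)" for x
    using d by (simp add: matrix_vector_mult_diff_rdistrib outer_square_mult_vec w_def field_simps
        flip: d_def)
  show "psd (A - outer_square w)"
    unfolding psd_def
  proof (intro conjI allI)
    show "transpose (A - outer_square w) = A - outer_square w"
      using A transpose_outer_square[of w] by (simp add: psd_def transpose_def vec_eq_iff)
    fix x
    \<comment> \<open>The parameter that minimises the form on the line through \<open>x\<close> with direction \<open>e\<close>.\<close>
    define t where "t = - (e \<bullet> (A *v x)) / d"
    have "0 \<le> x \<bullet> (A *v x) + 2 * t * (e \<bullet> (A *v x)) + t\<^sup>2 * d"
      using psd_nonneg[OF A, of "x + t *\<^sub>R e"]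
      by (simp add: quadratic_form_add_scaled[OF A] flip: d_def)
    also have "\<dots> = x \<bullet> (A *v x) - (e \<bullet> (A *v x))\<^sup>2 / d"
      using d by (simp add: t_def field_simps power2_eq_square)
    also have "\<dots> = x \<bullet> ((A - outer_square w) *v x)"
      using psd_symmetric[OF A, of x e]
      by (simp add: mult inner_diff_right inner_commute power2_eq_square)
    finally show "0 \<le> x \<bullet> ((A - outer_square w) *v x)" .
  qed
  let ?R = "range (\<lambda>x. A *v x)" and ?R' = "range (\<lambda>x. (A - outer_square w) *v x)"
  have sub: "?R' \<subseteq> ?R"
  proof clarify
    fix x
    have "(A - outer_square w) *v x = A *v (x - ((A *v e) \<bullet> x / d) *\<^sub>R e)"
      by (simp add: mult matrix_vector_mult_diff_distrib matrix_vector_mult_scaleR)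
    then show "(A - outer_square w) *v x \<in> ?R"
      by blast
  qed
  have orth: "e \<bullet> y = 0" if y_in: "y \<in> ?R'" for y
  proof -
    obtain x where y: "y = (A - outer_square w) *v x"
      using y_in by blast
    have "e \<bullet> y = e \<bullet> (A *v x) - (A *v e) \<bullet> x / d * d"
      by (simp add: y mult inner_diff_right d_def)
    also have "\<dots> = 0"
      using d psd_symmetric[OF A, of e x] by (simp add: inner_commute)
    finally show ?thesis .
  qed
  have "A *v e \<notin> ?R'"
    using orth[of "A *v e"] pos by auto
  then have "?R' \<subset> ?R"
    using sub by blast
  moreover have "subspace ?R" "subspace ?R'"
    by (simp_all add: linear_subspace_image)
  ultimately have "dim ?R' < dim ?R"
    by (intro dim_psubset) (simp add: span_eq_iff[THEN iffD2])
  then show "rank (A - outer_square w) < rank A"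
    by (simp add: rank_dim_range)
qed

text \<open>
  Repeated elimination ends with the zero matrix after at most \<open>rank A\<close> steps. The vectors
  \<open>(w l $ i)\<^sub>l\<close> then have Gram matrix \<open>A\<close>.
\<close>

lemma psd_gram_decomposition:
  assumes "psd A"
  obtains r w where "r \<le> rank A" "A = (\<Sum>l<r. outer_square (w l))"
proof -
  have "\<exists>r w. r \<le> rank A \<and> A = (\<Sum>l<r. outer_square (w l))"
    using assms
  proof (induction "rank A" arbitrary: A rule: less_induct)
    case less
    show ?case
    proof (cases "A = 0")
      case True
      then show ?thesis
        by (intro exI[of _ 0]) simp
    next
      case False
      then obtain e where "A *v e \<noteq> 0"
        by (auto simp: matrix_eq)
      then have pos: "0 < e \<bullet> (A *v e)"
        using psd_quadratic_form_eq_0[OF less.prems] psd_nonneg[OF less.prems]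
        by (metis order_le_less)
      define v where "v = (1 / sqrt (e \<bullet> (A *v e))) *\<^sub>R (A *v e)"
      note deflate = psd_deflate[OF less.prems pos, folded v_def]
      obtain r w where r: "r \<le> rank (A - outer_square v)"
        and w: "A - outer_square v = (\<Sum>l<r. outer_square (w l))"
        using less.hyps[OF deflate(2,1)] by blast
      have "A = (\<Sum>l<Suc r. outer_square ((w(r := v)) l))"
        using w by (simp add: algebra_simps)
      moreover have "Suc r \<le> rank A"
        using r deflate(2) by simp
      ultimately show ?thesis
        by blast
    qed
  qed
  then obtain r w where "r \<le> rank A" "A = (\<Sum>l<r. outer_square (w l))"
    by (elim exE conjE)
  then show ?thesis
    by (rule that)
qed

lemma psd_trace_inner_nonneg:
  assumes A: "psd A" and B: "psd B"
  shows "0 \<le> trace_inner A B"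
proof -
  obtain r w where "r \<le> rank B" "B = (\<Sum>l<r. outer_square (w l))"
    by (rule psd_gram_decomposition[OF B])
  then show ?thesis
    by (auto simp: trace_inner_sum_right trace_inner_outer_square intro!: sum_nonneg psd_nonneg[OF A])
qed

text \<open>
  If \<open>B = \<Sum> w w\<^sup>T\<close>, then \<open>\<langle>A, B\<rangle>\<close> is the sum of the nonnegative numbers \<open>w\<^sup>T A w\<close>. They all vanish,
  so \<open>A\<close> kills each \<open>w\<close> and with them the range of \<open>B\<close>.
\<close>

lemma psd_trace_inner_eq_0:
  assumes A: "psd A" and B: "psd B" and eq: "trace_inner A B = 0"
  shows "A *v (B *v x) = 0"
proof -
  obtain r w where "r \<le> rank B" and w: "B = (\<Sum>l<r. outer_square (w l))"
    by (rule psd_gram_decomposition[OF B])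
  have "w l \<bullet> (A *v w l) = 0" if "l < r" for l
    using eq that psd_nonneg[OF A]
    by (simp add: w trace_inner_sum_right trace_inner_outer_square sum_nonneg_eq_0_iff)
  then have "A *v w l = 0" if "l < r" for l
    using that psd_quadratic_form_eq_0[OF A] by blast
  moreover have "A *v (B *v x) = (\<Sum>l<r. (w l \<bullet> x) *\<^sub>R (A *v w l))"
    by (simp add: w sum_mult_vec outer_square_mult_vec linear_sum[OF matrix_vector_mul_linear]
        matrix_vector_mult_scaleR)
  ultimately show ?thesis
    by simp
qed

text \<open>
  If \<open>A = \<Sum> w w\<^sup>T \<preceq> I\<close>, then each term is below \<open>I\<close>, which means \<open>w \<bullet> w \<le> 1\<close>. The trace
  is the sum of these numbers, at most \<open>rank A\<close> of them.
\<close>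

lemma trace_le_rank:
  assumes A: "psd A" and le: "A \<preceq> mat 1"
  shows "trace A \<le> real (rank A)"
proof -
  obtain r w where r: "r \<le> rank A" and w: "A = (\<Sum>l<r. outer_square (w l))"
    by (rule psd_gram_decomposition[OF A])
  have "w l \<bullet> w l \<le> 1" if "l < r" for l
  proof -
    have "(w l \<bullet> w l)\<^sup>2 \<le> (\<Sum>k<r. (w k \<bullet> w l)\<^sup>2)"
      using that by (intro member_le_sum) auto
    also have "\<dots> = w l \<bullet> (A *v w l)"
      by (simp add: w sum_mult_vec outer_square_mult_vec inner_sum_right inner_commute power2_eq_square)
    also have "\<dots> \<le> w l \<bullet> w l"
      using le psd_nonneg[of "mat 1 - A" "w l"]
      by (simp add: loewner_le_def matrix_vector_mult_diff_rdistrib inner_diff_right)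
    finally have sq: "(w l \<bullet> w l)\<^sup>2 \<le> w l \<bullet> w l" .
    show ?thesis
    proof (rule ccontr)
      assume "\<not> w l \<bullet> w l \<le> 1"
      then have "w l \<bullet> w l * 1 < w l \<bullet> w l * (w l \<bullet> w l)"
        by (intro mult_strict_left_mono) auto
      with sq show False
        by (simp add: power2_eq_square)
    qed
  qed
  then have "(\<Sum>l<r. w l \<bullet> w l) \<le> (\<Sum>l<r. 1)"
    by (intro sum_mono) auto
  moreover have "trace A = (\<Sum>l<r. w l \<bullet> w l)"
    by (simp add: w trace_inner_sum_right trace_inner_outer_square flip: trace_inner_mat_1)
  ultimately show ?thesis
    using r by simp
qed

text \<open>
  In terms of the decomposition \<open>A = \<Sum> w w\<^sup>T\<close>, each \<open>\<bar>w\<^sub>i w\<^sub>j\<bar>\<close> is at most \<open>w \<bullet> w\<close>. The bound makes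
  the feasible set of \<open>phi\<close> bounded.
\<close>

lemma psd_entry_le_trace:
  assumes A: "psd A"
  shows "\<bar>A $ i $ j\<bar> \<le> trace A"
proof -
  obtain r w where "r \<le> rank A" and w: "A = (\<Sum>l<r. outer_square (w l))"
    by (rule psd_gram_decomposition[OF A])
  have "\<bar>A $ i $ j\<bar> \<le> (\<Sum>l<r. \<bar>w l $ i * w l $ j\<bar>)"
    by (simp add: w outer_square_def)
  also have "\<dots> \<le> (\<Sum>l<r. w l \<bullet> w l)"
  proof (rule sum_mono)
    fix l
    have "\<bar>w l $ i * w l $ j\<bar> \<le> norm (w l) * norm (w l)"
      unfolding abs_mult by (intro mult_mono component_le_norm_cart) auto
    then show "\<bar>w l $ i * w l $ j\<bar> \<le> w l \<bullet> w l"
      by (simp add: power2_eq_square flip: power2_norm_eq_inner)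
  qed
  also have "\<dots> = trace A"
    by (simp add: w trace_inner_sum_right trace_inner_outer_square flip: trace_inner_mat_1)
  finally show ?thesis .
qed

lemma norm_le_trace:
  fixes A :: "real^'v::finite^'v"
  assumes A: "psd A"
  shows "norm A \<le> real CARD('v) * (real CARD('v) * trace A)"
proof -
  have "norm A \<le> (\<Sum>i\<in>UNIV. norm (A $ i))"
    by (simp add: norm_vec_def L2_set_le_sum)
  also have "\<dots> \<le> (\<Sum>i\<in>(UNIV::'v set). real CARD('v) * trace A)"
  proof (rule sum_mono)
    fix i
    have "norm (A $ i) \<le> (\<Sum>j\<in>UNIV. \<bar>A $ i $ j\<bar>)"
      by (rule norm_le_l1_cart)
    also have "\<dots> \<le> (\<Sum>j\<in>(UNIV::'v set). trace A)"
      by (intro sum_mono psd_entry_le_trace[OF A])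
    finally show "norm (A $ i) \<le> real CARD('v) * trace A"
      by simp
  qed
  finally show ?thesis
    by simp
qed

text \<open>
  The span of the \<open>m\<close> vectors may have dimension less than \<open>m\<close>. It is enlarged to a space of
  dimension exactly \<open>m\<close>, and \<open>P\<close> is the orthogonal projection onto that space.
\<close>

lemma projection_of_trace:
  fixes c :: "nat \<Rightarrow> real^'v::finite"
  assumes "m \<le> CARD('v)"
  obtains P :: "real^'v^'v" where "psd P" "P \<preceq> mat 1" "trace P = real m"
    "\<And>l. l < m \<Longrightarrow> P *v c l = c l"
proof -
  let ?S = "span (c ` {..<m})"
  obtain C where C: "independent C" "span C = ?S" "card C = dim ?S"
    using basis_exists[of ?S] by (metis span_subspace subspace_span)
  have "card C \<le> m"
    using dim_le_card'[of "c ` {..<m}"] card_image_le[of "{..<m}" c] C(3) by simp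
  let ?D = "extend_basis C"
  have D: "independent ?D" "C \<subseteq> ?D" "span ?D = UNIV"
    using C(1) independent_extend_basis extend_basis_superset span_extend_basis by auto
  have "card ?D = CARD('v)" "finite ?D"
    using D(1,3) by (metis DIM_cart DIM_real dim_UNIV dim_span_eq_card_independent mult.right_neutral)
      (use D(1) independent_imp_finite in blast)
  then obtain T where T: "C \<subseteq> T" "T \<subseteq> ?D" "card T = m"
    using exists_subset_between[of C m ?D] \<open>card C \<le> m\<close> assms D(2) by auto
  have "independent T"
    using D(1) T(2) independent_mono by blast
  then have dim: "dim (span T) = m"
    using T(3) dim_span_eq_card_independent by blast
  obtain B where orth: "pairwise orthogonal B" and unit: "\<And>b. b \<in> B \<Longrightarrow> norm b = 1"
    and card: "card B = m" and span: "span B = span T" and "independent B"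
    using orthonormal_basis_subspace[OF subspace_span[of T]] dim by metis
  have fin: "finite B"
    using \<open>independent B\<close> independent_imp_finite by blast
  define P where "P = (\<Sum>b\<in>B. outer_square b)"
  have P: "P *v x = (\<Sum>b\<in>B. (x \<bullet> b) *\<^sub>R b)" for x
    by (simp add: P_def sum_mult_vec outer_square_mult_vec inner_commute)
  have fixed: "P *v x = x" if "x \<in> span B" for x
    using orthonormal_basis_expand[OF orth unit that fin] by (simp add: P)
  have psd: "psd P"
    unfolding P_def by (rule psd_sum_outer_squares)
  show ?thesis
  proof
    show "psd P"
      by (rule psd)
    show "P \<preceq> mat 1"
      unfolding loewner_le_def psd_def
    proof (intro conjI allI)
      show "transpose (mat 1 - P) = mat 1 - P"
        using psd by (simp add: psd_def transpose_def mat_def vec_eq_iff)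
      fix x
      have "P *v x \<in> span B"
        unfolding P by (intro span_sum span_scale span_base)
      then have "(P *v x) \<bullet> (P *v x) = x \<bullet> (P *v x)"
        using psd_symmetric[OF psd, of "P *v x" x] fixed by simp
      then have "x \<bullet> ((mat 1 - P) *v x) = (x - P *v x) \<bullet> (x - P *v x)"
        by (simp add: matrix_vector_mult_diff_rdistrib inner_simps inner_commute)
      then show "0 \<le> x \<bullet> ((mat 1 - P) *v x)"
        by simp
    qed
    show "trace P = real m"
      using unit card by (simp add: P_def trace_inner_sum_right trace_inner_outer_square dot_square_norm
          flip: trace_inner_mat_1)
    show "P *v c l = c l" if "l < m" for l
    proof (rule fixed)
      have "c l \<in> ?S"
        using that by (simp add: span_base)
      then show "c l \<in> span B"
        unfolding span using C(2) span_mono[OF T(1)] by blast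
    qed
  qed
qed

section \<open>Orthonormal representations as Gram matrices\<close>

lemma complement_complement: "simple_graph G \<Longrightarrow> complement (complement G) = G"
  by (auto simp: fun_eq_iff complement_def simple_graph_def irreflp_def)

lemma adjacency_matrix_times_eq_0_iff:
  "adjacency_matrix G * Y = 0 \<longleftrightarrow> (\<forall>i j. G i j \<longrightarrow> Y $ i $ j = 0)"
  by (simp add: adjacency_matrix_def vec_eq_iff)

text \<open>
  The vector of vertex \<open>i\<close> consists of the \<open>i\<close>-th coordinates of \<open>w 0, ..., w (m - 1)\<close>, so
  that the sum is the Gram matrix of the representation.
\<close>

lemma orthonormal_representation_iff_gram:
  assumes "simple_graph G"
  shows "orthonormal_representation m (complement G) (\<lambda>i l. w l $ i) \<longleftrightarrow>
    diag (\<Sum>l<m. outer_square (w l)) = 1 \<and> adjacency_matrix G * (\<Sum>l<m. outer_square (w l)) = 0"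
  unfolding orthonormal_representation_def complement_complement[OF assms]
    adjacency_matrix_times_eq_0_iff
  by (simp add: L2_set_def diag_def vec_eq_iff outer_square_def power2_eq_square)

lemma diag_eq_1_iff: "diag Y = 1 \<longleftrightarrow> (\<forall>i. Y $ i $ i = 1)"
  by (simp add: diag_def vec_eq_iff)

lemma trace_eq_card_if_diag: "diag Y = 1 \<Longrightarrow> trace (Y :: real^'v::finite^'v) = real CARD('v)"
  by (simp add: trace_def diag_eq_1_iff)

lemma representation_of_feasible:
  fixes G :: "'v::finite \<Rightarrow> 'v \<Rightarrow> bool"
  assumes G: "simple_graph G" and feas: "phi_feasible G (real k) M Y"
    and eq: "trace_inner M Y = real CARD('v)"
  shows "\<exists>u. orthonormal_representation k (complement G) u"
proof -
  have M: "psd M" "M \<preceq> mat 1" "trace M = real k" and Y: "psd Y" "diag Y = 1" "adjacency_matrix G * Y = 0"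
    using feas by (auto simp: phi_feasible_def trace_inner_mat_1)
  define N where "N = mat 1 - M"
  have N: "psd N" "N \<preceq> mat 1"
    using M by (simp_all add: N_def loewner_le_def)
  have "trace_inner N Y = 0"
    using eq Y(2) by (simp add: N_def trace_inner_mat_1_diff trace_eq_card_if_diag)
  then have NY: "N *v (Y *v x) = 0" for x
    using psd_trace_inner_eq_0[OF N(1) Y(1)] by blast
  let ?R = "range ((*v) N)" and ?S = "range ((*v) Y)"
  have "x \<bullet> y = 0" if "x \<in> ?R" "y \<in> ?S" for x y
    using that NY psd_symmetric[OF N(1)] by (auto simp: inner_commute[of "N *v _"])
  then have "dim (?R \<union> ?S) = dim ?R + dim ?S"
    by (rule dim_orthogonal_sum)
  then have "rank N + rank Y \<le> CARD('v)"
    using dim_subset_UNIV[of "?R \<union> ?S"] by (simp add: rank_dim_range)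
  moreover have "real CARD('v) - real k \<le> real (rank N)"
    using trace_le_rank[OF N] M(3) by (simp add: N_def trace_sub trace_I)
  ultimately have "rank Y \<le> k"
    by linarith
  obtain r w where "r \<le> rank Y" and w: "Y = (\<Sum>l<r. outer_square (w l))"
    by (rule psd_gram_decomposition[OF Y(1)])
  then have r: "r \<le> k"
    using \<open>rank Y \<le> k\<close> by simp
  \<comment> \<open>Padding with zero vectors brings the dimension to exactly \<open>k\<close>.\<close>
  define w' where "w' l = (if l < r then w l else 0)" for l
  have "(\<Sum>l<k. outer_square (w' l)) = (\<Sum>l<r. outer_square (w' l))"
    using r by (intro sum.mono_neutral_right) (auto simp: w'_def outer_square_def vec_eq_iff)
  then have "Y = (\<Sum>l<k. outer_square (w' l))"
    by (simp add: w w'_def)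
  then have "orthonormal_representation k (complement G) (\<lambda>i l. w' l $ i)"
    using Y by (simp add: orthonormal_representation_iff_gram[OF G])
  then show ?thesis
    by blast
qed

lemma feasible_of_representation:
  fixes G :: "'v::finite \<Rightarrow> 'v \<Rightarrow> bool"
  assumes G: "simple_graph G" and u: "orthonormal_representation k (complement G) u"
    and k: "k \<le> CARD('v)"
  shows "\<exists>M Y. phi_feasible G (real k) M Y \<and> trace_inner M Y = real CARD('v)"
proof -
  define c :: "nat \<Rightarrow> real^'v" where "c l = (\<chi> i. u i l)" for l
  define Y where "Y = (\<Sum>l<k. outer_square (c l))"
  have Y: "psd Y" "diag Y = 1" "adjacency_matrix G * Y = 0"
    using orthonormal_representation_iff_gram[OF G, of k c] u psd_sum_outer_squares
    by (auto simp: Y_def c_def)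
  obtain P :: "real^'v^'v" where P: "psd P" "P \<preceq> mat 1" "trace P = real k"
    "\<And>l. l < k \<Longrightarrow> P *v c l = c l"
    using projection_of_trace[OF k, of c] by blast
  have "trace_inner P Y = (\<Sum>l<k. c l \<bullet> c l)"
    using P(4) by (simp add: Y_def trace_inner_sum_right trace_inner_outer_square)
  also have "\<dots> = trace Y"
    by (simp add: Y_def trace_inner_sum_right trace_inner_outer_square flip: trace_inner_mat_1)
  also have "\<dots> = real CARD('v)"
    using Y(2) by (rule trace_eq_card_if_diag)
  finally show ?thesis
    using P Y by (auto simp: phi_feasible_def trace_inner_mat_1)
qed

lemma ex_representation_of_dimension_card:
  fixes G :: "'v::finite \<Rightarrow> 'v \<Rightarrow> bool"
  assumes G: "simple_graph G"
  shows "\<exists>u. orthonormal_representation CARD('v) (complement G) u"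
proof -
  obtain f where f: "bij_betw f (UNIV :: 'v set) {..<CARD('v)}"
    using ex_bij_betw_finite_nat[of "UNIV :: 'v set"] by (auto simp: atLeast0LessThan)
  have less: "f i < CARD('v)" and inj: "f i = f j \<longleftrightarrow> i = j" for i j
    using f by (auto simp: bij_betw_def inj_on_def)
  have "orthonormal_representation CARD('v) (complement G) (\<lambda>i l. if l = f i then 1 else 0)"
    using less inj by (auto simp: orthonormal_representation_def L2_set_def complement_def
        if_distrib[where f = "\<lambda>x. x\<^sup>2"] if_distrib[where f = "\<lambda>x. x * _"] cong: if_cong)
  then show ?thesis
    by blast
qed

section \<open>The maximum defining phi\<close>

lemma phi_feasible_le_card:
  fixes G :: "'v::finite \<Rightarrow> 'v \<Rightarrow> bool"
  assumes "phi_feasible G k M Y"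
  shows "trace_inner M Y \<le> real CARD('v)"
proof -
  have "0 \<le> trace_inner (mat 1 - M) Y"
    using assms by (intro psd_trace_inner_nonneg) (auto simp: phi_feasible_def loewner_le_def)
  then show ?thesis
    using assms by (simp add: phi_feasible_def trace_inner_mat_1_diff trace_eq_card_if_diag)
qed

text \<open>
  A witness that the feasible set is nonempty, without which there is no maximum.
\<close>

lemma phi_feasible_scaled_mat_1:
  fixes G :: "'v::finite \<Rightarrow> 'v \<Rightarrow> bool"
  assumes G: "simple_graph G" and k: "0 \<le> k" "k \<le> real CARD('v)"
  shows "phi_feasible G k ((k / real CARD('v)) *\<^sub>R mat 1) (mat 1)"
proof -
  let ?c = "k / real CARD('v)"
  have c: "0 \<le> ?c" "?c \<le> 1"
    using k by (simp_all add: divide_le_eq_1)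
  have "mat 1 - ?c *\<^sub>R mat 1 = ((1 - ?c) *\<^sub>R mat 1 :: real^'v^'v)"
    by (simp add: scaleR_left_diff_distrib)
  then have "?c *\<^sub>R mat 1 \<preceq> (mat 1 :: real^'v^'v)"
    using psd_scaled_mat_1[of "1 - ?c"] c by (simp add: loewner_le_def)
  moreover have "psd (mat 1 :: real^'v^'v)"
    using psd_scaled_mat_1[of 1] by simp
  moreover have "psd (?c *\<^sub>R mat 1 :: real^'v^'v)"
    using c by (intro psd_scaled_mat_1)
  moreover have "trace (?c *\<^sub>R mat 1 :: real^'v^'v) = k"
    by (simp add: trace_def mat_def)
  moreover have "diag (mat 1 :: real^'v^'v) = 1"
    by (simp add: diag_def mat_def vec_eq_iff)
  moreover have "adjacency_matrix G * mat 1 = 0"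
    using G by (auto simp: adjacency_matrix_times_eq_0_iff mat_def simple_graph_def irreflp_def)
  ultimately show ?thesis
    by (simp add: phi_feasible_def trace_inner_mat_1)
qed

lemma closed_psd_preimage:
  assumes "continuous_on UNIV f"
  shows "closed {p. psd (f p :: real^'v::finite^'v)}"
proof -
  have "closed {p. (\<forall>i j. f p $ i $ j = f p $ j $ i)
      \<and> (\<forall>x. 0 \<le> (\<Sum>i\<in>UNIV. x $ i * (\<Sum>j\<in>UNIV. f p $ i $ j * x $ j)))}"
    by (intro closed_Collect_conj closed_Collect_all closed_Collect_eq closed_Collect_le
        continuous_intros assms)
  moreover have "{p. psd (f p)} = {p. (\<forall>i j. f p $ i $ j = f p $ j $ i)
      \<and> (\<forall>x. 0 \<le> (\<Sum>i\<in>UNIV. x $ i * (\<Sum>j\<in>UNIV. f p $ i $ j * x $ j)))}"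
    by (intro Collect_cong)
      (auto simp: psd_def transpose_def vec_eq_iff inner_vec_def matrix_vector_mult_def)
  ultimately show ?thesis
    by (simp only:)
qed

lemma compact_phi_feasible:
  fixes G :: "'v::finite \<Rightarrow> 'v \<Rightarrow> bool"
  shows "compact {(M, Y). phi_feasible G k M Y}"
  unfolding compact_eq_bounded_closed
proof
  let ?n = "real CARD('v)"
  have "{(M, Y). phi_feasible G k M Y} \<subseteq> cball 0 (?n * (?n * k)) \<times> cball 0 (?n * (?n * ?n))"
  proof (rule subrelI)
    fix M Y
    assume "(M, Y) \<in> {(M, Y). phi_feasible G k M Y}"
    then have "phi_feasible G k M Y"
      by simp
    then have "psd M" "trace M = k" "psd Y" "trace Y = ?n"
      by (simp_all add: phi_feasible_def trace_inner_mat_1 trace_eq_card_if_diag)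
    then show "(M, Y) \<in> cball 0 (?n * (?n * k)) \<times> cball 0 (?n * (?n * ?n))"
      using norm_le_trace[of M] norm_le_trace[of Y] by simp
  qed
  then show "bounded {(M, Y). phi_feasible G k M Y}"
    by (rule bounded_subset[rotated]) (intro bounded_Times bounded_cball)
  let ?C = "{p. psd (fst p) \<and> psd (snd p) \<and> (\<forall>i. snd p $ i $ i = 1)
      \<and> (\<forall>i j. G i j \<longrightarrow> snd p $ i $ j = 0)
      \<and> (\<Sum>i\<in>UNIV. fst p $ i $ i) = k \<and> psd (mat 1 - fst p)}"
  have eq: "{(M, Y). phi_feasible G k M Y} = ?C"
    by (intro set_eqI) (simp only: mem_Collect_eq split_beta phi_feasible_def
        adjacency_matrix_times_eq_0_iff trace_inner_mat_1 trace_def loewner_le_def diag_eq_1_iff)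
  show "closed {(M, Y). phi_feasible G k M Y}"
    unfolding eq
    by (intro closed_Collect_conj closed_psd_preimage closed_Collect_all closed_Collect_imp
        closed_Collect_eq continuous_intros open_Collect_const)
qed

text \<open>
  \<open>phi\<close> is an unspecified number unless the maximum exists, which is a consequence of compactness.
\<close>

lemma phi_attained:
  fixes G :: "'v::finite \<Rightarrow> 'v \<Rightarrow> bool"
  assumes G: "simple_graph G" and k: "0 \<le> k" "k \<le> real CARD('v)"
  obtains M Y where "phi_feasible G k M Y" "phi G k = trace_inner M Y"
    "\<And>M' Y'. phi_feasible G k M' Y' \<Longrightarrow> trace_inner M' Y' \<le> phi G k"
proof -
  let ?F = "{(M, Y). phi_feasible G k M Y}" and ?f = "\<lambda>p. trace_inner (fst p) (snd p)"
  have "continuous_on ?F ?f"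
    unfolding trace_inner_entries by (intro continuous_intros)
  moreover have "?F \<noteq> {}"
    using phi_feasible_scaled_mat_1[OF assms] by blast
  ultimately obtain p where p: "p \<in> ?F" "\<forall>q\<in>?F. ?f q \<le> ?f p"
    using continuous_attains_sup[OF compact_phi_feasible] by blast
  then have "phi G k = ?f p"
    unfolding phi_def by (intro Greatest_equality) (force, auto)
  with p show ?thesis
    by (intro that[of "fst p" "snd p"]) auto
qed

lemma phi_eq_card_iff:
  fixes G :: "'v::finite \<Rightarrow> 'v \<Rightarrow> bool"
  assumes G: "simple_graph G" and k: "k \<le> CARD('v)"
  shows "phi G (real k) = real CARD('v) \<longleftrightarrow> (\<exists>u. orthonormal_representation k (complement G) u)"
proof -
  obtain M Y where MY: "phi_feasible G (real k) M Y" "phi G (real k) = trace_inner M Y"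
    and max: "\<And>M' Y'. phi_feasible G (real k) M' Y' \<Longrightarrow> trace_inner M' Y' \<le> phi G (real k)"
    using phi_attained[OF G, of "real k"] k by auto
  show ?thesis
  proof
    assume "phi G (real k) = real CARD('v)"
    then show "\<exists>u. orthonormal_representation k (complement G) u"
      using representation_of_feasible[OF G MY(1)] MY(2) by simp
  next
    assume "\<exists>u. orthonormal_representation k (complement G) u"
    then have "real CARD('v) \<le> phi G (real k)"
      using feasible_of_representation[OF G _ k] max by metis
    then show "phi G (real k) = real CARD('v)"
      using phi_feasible_le_card[OF MY(1)] MY(2) by simp
  qed
qed

theorem theorem10:
  fixes G :: "'v::finite \<Rightarrow> 'v \<Rightarrow> bool"
  assumes "simple_graph G"
  shows "int (xi (complement G)) =
    Min {k::int. 0 \<le> k \<and> k \<le> int CARD('v) \<and> phi G (real_of_int k) = real CARD('v)}"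
proof -
  let ?rep = "\<lambda>m. \<exists>u. orthonormal_representation m (complement G) u"
  let ?K = "{k::int. 0 \<le> k \<and> k \<le> int CARD('v) \<and> phi G (real_of_int k) = real CARD('v)}"
  have K: "?K = int ` {m. m \<le> CARD('v) \<and> ?rep m}"
  proof (intro equalityI subsetI)
    fix k assume k: "k \<in> ?K"
    then obtain m where m: "k = int m"
      using nonneg_int_cases by blast
    have "m \<le> CARD('v)" "phi G (real m) = real CARD('v)"
      using k by (simp_all add: m)
    then show "k \<in> int ` {m. m \<le> CARD('v) \<and> ?rep m}"
      using phi_eq_card_iff[OF assms, of m] by (simp add: m)
  next
    fix k assume "k \<in> int ` {m. m \<le> CARD('v) \<and> ?rep m}"
    then obtain m where m: "k = int m" "m \<le> CARD('v)" "?rep m"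
      by blast
    have "phi G (real m) = real CARD('v)"
      using phi_eq_card_iff[OF assms m(2)] m(3) by blast
    then show "k \<in> ?K"
      using m(1,2) by simp
  qed
  have rep: "?rep CARD('v)"
    by (rule ex_representation_of_dimension_card[OF assms])
  have xi: "?rep (xi (complement G))"
    unfolding xi_def using rep by (rule LeastI)
  have xi_le: "xi (complement G) \<le> m" if "?rep m" for m
    unfolding xi_def using that by (rule Least_le)
  show ?thesis
    unfolding K
  proof (rule Min_eqI[symmetric])
    show "finite (int ` {m. m \<le> CARD('v) \<and> ?rep m})"
      by simp
    show "int (xi (complement G)) \<in> int ` {m. m \<le> CARD('v) \<and> ?rep m}"
      using xi xi_le[OF rep] by simp
    fix y
    assume "y \<in> int ` {m. m \<le> CARD('v) \<and> ?rep m}"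
    then obtain m where "y = int m" "?rep m"
      by blast
    then show "int (xi (complement G)) \<le> y"
      using xi_le by simp
  qed
qed

end
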